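(* Let $\mathfrak{S}$ be a board with no isolated point. Then $2\,\mathscr{F}(\mathfrak{S},\mathbb{Z})\subseteq V(\mathfrak{S},\mathbb{Z})$, i.e. every function $\mathfrak{S}\to 2\mathbb{Z}$ is an integer linear combination of moves.
   Context: A board $\mathfrak{S}$ is a finite subset of $\mathbb{Z}^2$. $\mathscr{F}(\mathfrak{S},\mathbb{Z})$ is the $\mathbb{Z}$-module of integer-valued functions on $\mathfrak{S}$; $[P]$ is the function equal to $1$ at $P$ and $0$ elsewhere. The set of moves $\mathscr{D}(\mathfrak{S})$ consists of all functions $[P]+[Q]-[R]$ with $P,Q,R\in\mathfrak{S}$, $Q=P+v$, $R=P+2v$ for some $v\in\{(\pm1,0),(0,\pm1)\}$; $Q$ is called the middle point of the move and $P,R$ its extremities. $V(\mathfrak{S},\mathbb{Z})$ is the $\mathbb{Z}$-span of $\mathscr{D}(\mathfrak{S})$. Two points $P,R$ are neighbors if they are the two extremities of some move; $\equiv$ denotes the equivalence relation on $\mathfrak{S}$ that is the reflexive and transitive closure of the neighbor relation. The board has no isolated point if for every $P\in\mathfrak{S}$ there is $Q\equiv P$ which is the middle point of some move. *)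

theory Defs
  imports Complex_Main "HOL-Library.Function_Algebras" "HOL-Library.Product_Plus"
begin

type_synonym point = "int \<times> int"

text \<open>Integer-valued functions on a board are encoded as functions on the whole lattice
  that vanish off the board.\<close>

definition board_functions :: "point set \<Rightarrow> (point \<Rightarrow> int) set" where
  "board_functions S = {f. \<forall>P. P \<notin> S \<longrightarrow> f P = 0}"

definition point_fun :: "point \<Rightarrow> point \<Rightarrow> int" where
  "point_fun P = (\<lambda>X. if X = P then 1 else 0)"

definition is_jump :: "point set \<Rightarrow> point \<Rightarrow> point \<Rightarrow> point \<Rightarrow> bool" where
  "is_jump S P Q R \<longleftrightarrow> P \<in> S \<and> Q \<in> S \<and> R \<in> S \<and>
     (\<exists>v \<in> {(1, 0), (-1, 0), (0, 1), (0, -1)}. Q = P + v \<and> R = P + (v + v))"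

definition moves :: "point set \<Rightarrow> (point \<Rightarrow> int) set" where
  "moves S = {point_fun P + point_fun Q - point_fun R | P Q R. is_jump S P Q R}"

definition middle_point :: "point set \<Rightarrow> point \<Rightarrow> bool" where
  "middle_point S Q \<longleftrightarrow> (\<exists>P R. is_jump S P Q R)"

definition neighbor :: "point set \<Rightarrow> point \<Rightarrow> point \<Rightarrow> bool" where
  "neighbor S P R \<longleftrightarrow> (\<exists>Q. is_jump S P Q R)"

definition board_equiv :: "point set \<Rightarrow> point \<Rightarrow> point \<Rightarrow> bool" where
  "board_equiv S P Q \<longleftrightarrow> P \<in> S \<and> Q \<in> S \<and> (neighbor S)\<^sup>*\<^sup>* P Q"

definition no_isolated_point :: "point set \<Rightarrow> bool" where
  "no_isolated_point S \<longleftrightarrow> (\<forall>P \<in> S. \<exists>Q. board_equiv S P Q \<and> middle_point S Q)"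

definition int_scale :: "int \<Rightarrow> (point \<Rightarrow> int) \<Rightarrow> point \<Rightarrow> int" where
  "int_scale c f = (\<lambda>X. c * f X)"

global_interpretation int_fun: module int_scale
  by unfold_locales (auto simp: int_scale_def fun_eq_iff algebra_simps)

definition move_span :: "point set \<Rightarrow> (point \<Rightarrow> int) set" where
  "move_span S = int_fun.span (moves S)"

end

theory Submission
  imports Defs
begin

text \<open>The two moves with extremities \<open>P\<close>, \<open>R\<close> and middle point \<open>Q\<close> have sum \<open>2[Q]\<close> and
  difference \<open>2[P] - 2[R]\<close>. Hence \<open>2[Q]\<close> lies in the span for every middle point \<open>Q\<close>, and membership
  of \<open>2[P]\<close> in the span is invariant under the neighbor relation, so without isolated points it
  holds for all \<open>P\<close> on the board.\<close>

text \<open>The four directions are closed under negation, so \<open>-v\<close> witnesses the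
  reversed jump. This supplies the second of the two moves sharing extremities and middle
  point.\<close>

lemma is_jump_sym:
  assumes "is_jump S P Q R"
  shows "is_jump S R Q P"
  using assms unfolding is_jump_def by (auto simp: plus_prod_def)

lemma jump_in_move_span:
  assumes "is_jump S P Q R"
  shows "point_fun P + point_fun Q - point_fun R \<in> move_span S"
  unfolding move_span_def by (rule int_fun.span_base) (use assms in \<open>unfold moves_def, blast\<close>)

lemma twice_middle_point_in_move_span:
  assumes "middle_point S Q"
  shows "int_scale 2 (point_fun Q) \<in> move_span S"
proof -
  obtain P R where jump: "is_jump S P Q R"
    using assms by (auto simp: middle_point_def)
  have "int_scale 2 (point_fun Q) =
      (point_fun P + point_fun Q - point_fun R) + (point_fun R + point_fun Q - point_fun P)"
    by (simp add: int_scale_def fun_eq_iff)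
  then show ?thesis
    using jump_in_move_span[OF jump] jump_in_move_span[OF is_jump_sym[OF jump]]
    by (simp only: move_span_def int_fun.span_add)
qed

lemma twice_neighbor_in_move_span:
  assumes "neighbor S P R" and R: "int_scale 2 (point_fun R) \<in> move_span S"
  shows "int_scale 2 (point_fun P) \<in> move_span S"
proof -
  obtain Q where jump: "is_jump S P Q R"
    using assms by (auto simp: neighbor_def)
  have "int_scale 2 (point_fun P) =
      ((point_fun P + point_fun Q - point_fun R) - (point_fun R + point_fun Q - point_fun P))
      + int_scale 2 (point_fun R)"
    by (simp add: int_scale_def fun_eq_iff)
  then show ?thesis
    using jump_in_move_span[OF jump] jump_in_move_span[OF is_jump_sym[OF jump]] R
    by (simp only: move_span_def int_fun.span_add int_fun.span_diff)
qed

lemma twice_point_in_move_span: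
  assumes "no_isolated_point S" "P \<in> S"
  shows "int_scale 2 (point_fun P) \<in> move_span S"
proof -
  obtain Q where "(neighbor S)\<^sup>*\<^sup>* P Q" and "middle_point S Q"
    using assms by (auto simp: no_isolated_point_def board_equiv_def)
  then show ?thesis
    \<comment> \<open>The induction starts at the far end \<open>Q\<close> of the chain, where the
      middle point gives the base case, and walks back to \<open>P\<close> one neighbor at a
      time.\<close>
    by (induction rule: converse_rtranclp_induct)
      (auto intro: twice_middle_point_in_move_span twice_neighbor_in_move_span)
qed

text \<open>Reduces the claim to single points. Off \<open>S\<close> every summand vanishes, and so
  does \<open>f\<close> as a board function.\<close>

lemma board_function_eq_sum_point_fun:
  assumes "finite S" "f \<in> board_functions S"
  shows "f = (\<Sum>P\<in>S. int_scale (f P) (point_fun P))"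
proof
  fix X
  have "(\<Sum>P\<in>S. int_scale (f P) (point_fun P)) X = (\<Sum>P\<in>S. int_scale (f P) (point_fun P) X)"
    using assms(1) by (induction rule: finite_induct) auto
  also have "\<dots> = (\<Sum>P\<in>S. if X = P then f P else 0)"
    by (intro sum.cong) (auto simp: int_scale_def point_fun_def)
  also have "\<dots> = f X"
    using assms by (simp add: board_functions_def del: split_paired_All)
  finally show "f X = (\<Sum>P\<in>S. int_scale (f P) (point_fun P)) X" by simp
qed

lemma twice_board_function_in_move_span:
  assumes "finite S" "no_isolated_point S" "f \<in> board_functions S"
  shows "int_scale 2 f \<in> move_span S"
proof -
  \<comment> \<open>The factor 2 commutes past the coefficients \<open>f P\<close> onto the point
    functions, whose doubles lie in the span.\<close>
  have "int_scale 2 f = (\<Sum>P\<in>S. int_scale (f P) (int_scale 2 (point_fun P)))"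
    by (subst board_function_eq_sum_point_fun[OF assms(1,3)])
      (simp only: int_fun.scale_sum_right int_fun.scale_scale mult.commute)
  also have "\<dots> \<in> move_span S"
    using twice_point_in_move_span[OF assms(2)] unfolding move_span_def
    by (intro int_fun.span_sum) (rule int_fun.span_scale)
  finally show ?thesis .
qed

text \<open>Finiteness lets \<open>int_fun.span_finite\<close> turn membership in the span into one
  explicit sum over all moves.\<close>

lemma finite_moves:
  assumes "finite S"
  shows "finite (moves S)"
proof (rule finite_subset)
  show "moves S \<subseteq> (\<lambda>(P, Q, R). point_fun P + point_fun Q - point_fun R) ` (S \<times> S \<times> S)"
    by (force simp: moves_def is_jump_def)
qed (use assms in simp)

theorem theorem1:
  fixes S :: "point set"
  assumes "finite S"
    and "no_isolated_point S"
  shows "int_scale 2 ` board_functions S \<subseteq> move_span S \<and>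
    (\<forall>g \<in> board_functions S. (\<forall>P \<in> S. even (g P)) \<longrightarrow>
       (\<exists>c :: (point \<Rightarrow> int) \<Rightarrow> int. g = (\<Sum>m \<in> moves S. int_scale (c m) m)))"
proof (intro conjI ballI impI)
  show "int_scale 2 ` board_functions S \<subseteq> move_span S"
    using twice_board_function_in_move_span[OF assms] by blast
next
  fix g assume g: "g \<in> board_functions S" and ev: "\<forall>P \<in> S. even (g P)"
  define f where "f = (\<lambda>P. g P div 2)"
  have "f \<in> board_functions S"
    using g by (simp add: f_def board_functions_def)
  \<comment> \<open>Off the board \<open>g\<close> is 0, hence even too, so halving by
    \<open>div\<close> is exact at every lattice point.\<close>
  moreover have "even (g P)" for P
    using g ev by (cases "P \<in> S") (auto simp: board_functions_def simp del: split_paired_All)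
  then have "g = int_scale 2 f"
    by (simp add: f_def int_scale_def)
  ultimately have "g \<in> int_fun.span (moves S)"
    using twice_board_function_in_move_span[OF assms] by (simp add: move_span_def)
  then show "\<exists>c. g = (\<Sum>m \<in> moves S. int_scale (c m) m)"
    by (auto simp: int_fun.span_finite[OF finite_moves[OF assms(1)]])
qed

end
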